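(* Let $p\geq 3$ be a prime and let $\mathcal{S}=(s_n)_{n=0}^\infty$ be the explicit inversive congruential generator over $\mathbb{F}_p$, defined by $s_n=n^{p-2}\bmod p$ for $n=0,1,\ldots$. Then $\mathcal{S}$ has maximal expansion complexity for all $N=2,\ldots,p-1$, i.e. for every integer $N$ with $2\leq N\leq p-1$ and every positive integer $d$, $$E_N(\mathcal{S})=d\quad\text{whenever}\quad\binom{d+1}{2}\leq N<\binom{d+2}{2}.$$
   Context: For a sequence $\mathcal{S}=(s_i)_{i=0}^\infty$ over $\mathbb{F}_p$, its generating function is the formal power series $G(x)=\sum_{i=0}^\infty s_i x^i$ over $\mathbb{F}_p$. For a positive integer $N$, the $N$th expansion complexity $E_N(\mathcal{S})$ is defined to be $0$ if $s_0=\dots=s_{N-1}=0$, and otherwise the least total degree of a nonzero polynomial $h(x,y)\in\mathbb{F}_p[x,y]$ with $h(x,G(x))\equiv 0 \bmod x^N$. The value $n^{p-2}\bmod p$ is regarded as an element of $\mathbb{F}_p$. *)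

theory Defs
  imports
    "HOL-Computational_Algebra.Polynomial_FPS"
    "Berlekamp_Zassenhaus.Finite_Field"
begin

text \<open>
  A bivariate polynomial \<open>h(x, y)\<close> is a \<open>'a poly poly\<close>, with outer variable \<open>y\<close> and inner
  variable \<open>x\<close>: the coefficient of \<open>x\<^sup>i y\<^sup>j\<close> is \<open>coeff (coeff h j) i\<close>.
  The inserted \<open>0\<close> only matters for \<open>h = 0\<close>, whose total degree is thereby \<open>0\<close>, in
  accordance with \<open>degree\<close>.
\<close>

definition total_degree :: "'a::zero poly poly \<Rightarrow> nat" where
  "total_degree h = Max (insert 0 {i + j | i j. poly.coeff (poly.coeff h j) i \<noteq> 0})"

definition subst_fps :: "'a::comm_ring_1 poly poly \<Rightarrow> 'a fps \<Rightarrow> 'a fps" where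
  "subst_fps h G = poly (map_poly fps_of_poly h) G"

definition generating_function :: "(nat \<Rightarrow> 'a) \<Rightarrow> 'a fps" where
  "generating_function s = Abs_fps s"

text \<open>
  The minimum is over a nonempty set, since \<open>h(x, y) = x\<^sup>N\<close> qualifies.
\<close>

definition expansion_complexity :: "nat \<Rightarrow> (nat \<Rightarrow> 'a::comm_ring_1) \<Rightarrow> nat" where
  "expansion_complexity N s =
     (if \<forall>i<N. s i = 0 then 0
      else (LEAST D. \<exists>h. h \<noteq> 0 \<and> total_degree h = D \<and>
              fps_X ^ N dvd subst_fps h (generating_function s)))"

text \<open>
  The field with \<open>p\<close> elements is \<open>'p mod_ring\<close> for a type \<open>'p\<close> with \<open>p = CARD('p)\<close>;
  the class \<open>prime_card\<close> says that this cardinality is prime.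
\<close>

definition explicit_inversive :: "nat \<Rightarrow> 'p::prime_card mod_ring" where
  "explicit_inversive n = of_nat (n ^ (CARD('p) - 2) mod CARD('p))"

end

theory Submission
  imports Defs
begin

text \<open>
  Modulo \<open>X\<^sup>p\<close> the generating function \<open>G\<close> is \<open>- log (1 - X)\<close>, so \<open>(1 - X) G' \<equiv> 1\<close> modulo
  \<open>X\<^sup>p\<^sup>-\<^sup>1\<close>. Write \<open>h(X, G)\<close> as a sum of terms \<open>(1 - X)\<^sup>a q\<^sub>a(G)\<close>. The operator
  \<open>f \<mapsto> (1 - X) f' + b f\<close> lowers the order of vanishing by at most one and replaces \<open>q\<^sub>a\<close> by
  \<open>(b - a) q\<^sub>a + q\<^sub>a'\<close>: this keeps the degree for \<open>a \<noteq> b\<close> and lowers it by one for \<open>a = b\<close>.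
  Inductively, a nonzero sum vanishes to an order less than the number of available coefficients,
  which is the lower bound on the complexity. Counting coefficients gives the upper bound.
\<close>

section \<open>Orders of vanishing and derivatives of power series\<close>

lemma fps_X_power_dvd_iff_nth:
  fixes f :: "'a::comm_ring_1 fps"
  shows "fps_X ^ n dvd f \<longleftrightarrow> (\<forall>i<n. fps_nth f i = 0)"
proof
  assume "\<forall>i<n. fps_nth f i = 0"
  then have "f = fps_X ^ n * fps_shift n f"
    by (intro fps_ext) (auto simp: fps_X_power_mult_nth)
  then show "fps_X ^ n dvd f" by (metis dvd_triv_left)
qed (auto simp: dvd_def fps_X_power_mult_nth)

lemma fps_X_power_dvd_deriv:
  fixes f :: "'a::comm_ring_1 fps"
  assumes "fps_X ^ Suc n dvd f"
  shows "fps_X ^ n dvd fps_deriv f"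
  using assms by (auto simp: fps_X_power_dvd_iff_nth simp del: of_nat_Suc power_Suc)

abbreviation eval_const :: "'a::field poly \<Rightarrow> 'a fps \<Rightarrow> 'a fps" where
  "eval_const q G \<equiv> poly (map_poly fps_const q) G"

lemma eval_const_pCons: "eval_const (pCons c q) G = fps_const c + G * eval_const q G"
  by (cases "c = 0 \<and> q = 0") auto

lemma eval_const_add: "eval_const (q + r) G = eval_const q G + eval_const r G"
  by (induction q r rule: poly_induct2) (simp_all add: eval_const_pCons algebra_simps flip: fps_const_add)

lemma eval_const_smult: "eval_const (Polynomial.smult c q) G = fps_const c * eval_const q G"
  by (induction q) (simp_all add: eval_const_pCons algebra_simps)

lemma fps_deriv_eval_const:
  "fps_deriv (eval_const q G) = eval_const (pderiv q) G * fps_deriv G"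
  by (induction q) (simp_all add: pderiv_pCons eval_const_pCons eval_const_add algebra_simps)

text \<open>The powers of \<open>1 - X\<close> are eigenvectors of the operator
  \<open>(1 - X) d/dX\<close>, with eigenvalue \<open>- a\<close>. This is why sums are written in
  powers of \<open>1 - X\<close> and not of \<open>X\<close>.\<close>

lemma fps_deriv_one_minus_X_power:
  "(1 - fps_X) * fps_deriv ((1 - fps_X) ^ a :: 'a::comm_ring_1 fps) = - of_nat a * (1 - fps_X) ^ a"
proof (cases a)
  case (Suc n)
  have "fps_deriv ((1 - fps_X) ^ a :: 'a fps) = - of_nat a * (1 - fps_X) ^ n"
    by (simp only: fps_deriv_power') (simp add: Suc)
  then show ?thesis by (simp add: Suc mult.left_commute)
qed simp

section \<open>Coefficient counts under differentiation, and the bound on the order of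
  vanishing\<close>

lemma length_coeffs_smult_add_pderiv:
  fixes q :: "'a::field poly"
  assumes "c \<noteq> 0"
  shows "length (coeffs (Polynomial.smult c q + pderiv q)) = length (coeffs q)"
proof (cases "degree q = 0")
  case True
  then obtain b where "q = [:b:]" by (rule degree_eq_zeroE)
  with assms show ?thesis by (simp add: pderiv_pCons cCons_def)
next
  case False
  have le: "degree (pderiv q) < degree q"
    using False by (intro order.strict_trans1[OF degree_pderiv_le]) simp
  then have deg: "degree (Polynomial.smult c q + pderiv q) = degree q"
    using assms by (subst degree_add_eq_left) auto
  moreover have "q \<noteq> 0" using False by auto
  moreover have "Polynomial.smult c q + pderiv q \<noteq> 0"
    using deg False by auto
  ultimately show ?thesis by (simp add: length_coeffs_degree)
qed

text \<open>The leading coefficient is multiplied by the degree, which the hypothesis keeps nonzero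
  in the field when the degree is positive. Truncated subtraction covers
  \<open>q = 0\<close>.\<close>

lemma length_coeffs_pderiv:
  fixes q :: "'a::field poly"
  assumes "of_nat (degree q) = (0::'a) \<longrightarrow> degree q = 0"
  shows "length (coeffs (pderiv q)) = length (coeffs q) - 1"
proof (cases "degree q = 0")
  case True
  then obtain b where "q = [:b:]" by (rule degree_eq_zeroE)
  then show ?thesis by (simp add: pderiv_pCons cCons_def)
next
  case False
  then obtain n where n: "degree q = Suc n" by (cases "degree q") auto
  have "poly.coeff (pderiv q) n = of_nat (degree q) * lead_coeff q"
    by (simp add: coeff_pderiv n)
  moreover have "q \<noteq> 0" using False by auto
  ultimately have nz: "poly.coeff (pderiv q) n \<noteq> 0"
    using assms False by simp
  have "degree (pderiv q) \<le> n" using degree_pderiv_le[of q] n by simp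
  moreover have "n \<le> degree (pderiv q)" using nz by (rule le_degree)
  moreover have "pderiv q \<noteq> 0" using nz by auto
  ultimately show ?thesis using \<open>q \<noteq> 0\<close> n by (simp add: length_coeffs_degree)
qed

text \<open>The measure \<open>length (coeffs q)\<close> is the degree plus one for nonzero
  \<open>q\<close> and zero for \<open>q = 0\<close>, so the sum counts available coefficients
  without treating zero polynomials separately. The bound \<open>N \<le> M\<close> keeps the error
  in the differential equation and all degrees within the range of the hypotheses.\<close>

lemma log_combination_eq_zero:
  fixes G :: "'a::field fps" and q :: "nat \<Rightarrow> 'a poly"
  assumes G: "fps_X ^ M dvd (1 - fps_X) * fps_deriv G - 1"
    and char: "\<And>k. 0 < k \<Longrightarrow> k \<le> M \<Longrightarrow> of_nat k \<noteq> (0::'a)"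
    and A: "finite A" "inj_on (of_nat :: nat \<Rightarrow> 'a) A"
  assumes "fps_X ^ N dvd (\<Sum>a\<in>A. (1 - fps_X) ^ a * eval_const (q a) G)"
    and "(\<Sum>a\<in>A. length (coeffs (q a))) \<le> N" and "N \<le> M"
  shows "\<forall>a\<in>A. q a = 0"
  using assms(5-)
proof (induction N arbitrary: q)
  case 0
  then show ?case using A by simp
next
  case (Suc N)
  define f where "f = (\<Sum>a\<in>A. (1 - fps_X) ^ a * eval_const (q a) G)"
  show ?case
  proof (rule ccontr)
    assume "\<not> ?thesis"
    then obtain b where b: "b \<in> A" "q b \<noteq> 0" by auto
    define r where "r = (\<lambda>a. Polynomial.smult (of_nat b - of_nat a) (q a) + pderiv (q a))"
    \<comment> \<open>The count bounds the degree of \<open>q b\<close>, so a positive degree is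
      nonzero in the field and differentiation lowers the length by exactly one.\<close>
    have "length (coeffs (q b)) \<le> Suc N"
      using Suc.prems(2) member_le_sum[OF b(1), of "\<lambda>a. length (coeffs (q a))"] A by simp
    then have degb: "degree (q b) \<le> M"
      using b Suc.prems(3) by (simp add: length_coeffs_degree)
    have len_b: "length (coeffs (r b)) = length (coeffs (q b)) - 1"
      unfolding r_def using char[of "degree (q b)"] degb
      by (simp del: One_nat_def, intro length_coeffs_pderiv) auto
    have len: "length (coeffs (r a)) = length (coeffs (q a))" if "a \<in> A - {b}" for a
    proof -
      have "of_nat b \<noteq> (of_nat a :: 'a)" using A(2) b(1) that by (auto dest: inj_onD)
      then show ?thesis unfolding r_def by (intro length_coeffs_smult_add_pderiv) simp
    qed
    have "(\<Sum>a\<in>A. length (coeffs (r a))) \<le> N"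
    proof -
      have "(\<Sum>a\<in>A. length (coeffs (r a))) =
          length (coeffs (q b)) - 1 + (\<Sum>a\<in>A - {b}. length (coeffs (q a)))"
        using A(1) b(1) len len_b by (subst sum.remove[of A b]) simp_all
      moreover have "(\<Sum>a\<in>A. length (coeffs (q a))) =
          length (coeffs (q b)) + (\<Sum>a\<in>A - {b}. length (coeffs (q a)))"
        using A(1) b(1) by (rule sum.remove)
      moreover have "length (coeffs (q b)) > 0" using b by simp
      ultimately show ?thesis using Suc.prems(2) by linarith
    qed
    moreover have "fps_X ^ N dvd (\<Sum>a\<in>A. (1 - fps_X) ^ a * eval_const (r a) G)"
    proof -
      \<comment> \<open>The error \<open>?E\<close> in the logarithmic differential equation is
        carried along exactly and discarded only at the end, where \<open>X^N\<close> divides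
        it.\<close>
      let ?E = "(1 - fps_X) * fps_deriv G - 1"
      have term_eq: "(1 - fps_X) * fps_deriv ((1 - fps_X) ^ a * eval_const (q a) G)
          + of_nat b * ((1 - fps_X) ^ a * eval_const (q a) G)
        = (1 - fps_X) ^ a * eval_const (r a) G + ?E * ((1 - fps_X) ^ a * eval_const (pderiv (q a)) G)"
        for a
      proof -
        have "(1 - fps_X) * fps_deriv ((1 - fps_X) ^ a * eval_const (q a) G)
          = ((1 - fps_X) * fps_deriv ((1 - fps_X) ^ a)) * eval_const (q a) G
            + (1 - fps_X) ^ a * eval_const (pderiv (q a)) G * ((1 - fps_X) * fps_deriv G)"
          by (simp add: fps_deriv_eval_const algebra_simps)
        also have "\<dots> = - of_nat a * (1 - fps_X) ^ a * eval_const (q a) G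
            + (1 - fps_X) ^ a * eval_const (pderiv (q a)) G * (?E + 1)"
          unfolding fps_deriv_one_minus_X_power by simp
        finally have *: "(1 - fps_X) * fps_deriv ((1 - fps_X) ^ a * eval_const (q a) G) = \<dots>" .
        have "fps_const (of_nat b - of_nat a :: 'a) = of_nat b - of_nat a"
          by (simp flip: fps_of_nat)
        then have "eval_const (r a) G = (of_nat b - of_nat a) * eval_const (q a) G + eval_const (pderiv (q a)) G"
          unfolding r_def eval_const_add eval_const_smult by simp
        \<comment> \<open>A pure ring identity, to be read with \<open>x = a\<close>,
          \<open>y = b\<close>, \<open>w = (1 - X)^a\<close>, \<open>Q = q(G)\<close>,
          \<open>P = q'(G)\<close> and \<open>E = ?E\<close>.\<close>
        moreover have "- x * w * Q + w * P * (E + 1) + y * (w * Q) = w * ((y - x) * Q + P) + E * (w * P)"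
          for x y w P Q E :: "'a fps"
          by (simp add: algebra_simps)
        ultimately show ?thesis
          unfolding * by (simp only:)
      qed
      have "(1 - fps_X) * fps_deriv f + of_nat b * f =
          (\<Sum>a\<in>A. (1 - fps_X) ^ a * eval_const (r a) G)
          + ?E * (\<Sum>a\<in>A. (1 - fps_X) ^ a * eval_const (pderiv (q a)) G)"
        unfolding f_def fps_deriv_sum sum_distrib_left sum.distrib[symmetric] term_eq ..
      then have eq: "(\<Sum>a\<in>A. (1 - fps_X) ^ a * eval_const (r a) G) =
          (1 - fps_X) * fps_deriv f + of_nat b * f
          - ?E * (\<Sum>a\<in>A. (1 - fps_X) ^ a * eval_const (pderiv (q a)) G)"
        by simp
      have f: "fps_X ^ Suc N dvd f" using Suc.prems(1) unfolding f_def .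
      have "fps_X ^ N dvd f" by (rule power_le_dvd[OF f]) simp
      moreover have "fps_X ^ N dvd ?E" by (rule power_le_dvd[OF G]) (use Suc.prems(3) in simp)
      ultimately show ?thesis
        unfolding eq
        by (rule dvd_diff[OF dvd_add[OF dvd_mult[OF fps_X_power_dvd_deriv[OF f]] dvd_mult] dvd_mult2])
    qed
    ultimately have r0: "\<forall>a\<in>A. r a = 0"
      using Suc.prems(3) by (intro Suc.IH) auto
    \<comment> \<open>All \<open>r a\<close> vanish. Lengths are unchanged away from
      \<open>b\<close>, so those \<open>q a\<close> vanish too; at \<open>b\<close> the length
      dropped by one to zero, so \<open>q b\<close> is a nonzero constant.\<close>
    have q0: "q a = 0" if "a \<in> A - {b}" for a
      using len[OF that] r0 that by simp
    have "length (coeffs (q b)) = 1"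
      using len_b r0 b by (cases "coeffs (q b)") auto
    then have "degree (q b) = 0" using b(2) by (simp add: length_coeffs_degree)
    then obtain c where c: "q b = [:c:]" by (rule degree_eq_zeroE)
    \<comment> \<open>What is left of \<open>f\<close> has constant term \<open>c\<close>, which is
      nonzero, although \<open>f\<close> vanishes to order at least one.\<close>
    have "f = (1 - fps_X) ^ b * fps_const c"
      unfolding f_def using A(1) b(1) q0 c
      by (subst sum.remove[of A b]) (simp_all add: eval_const_pCons)
    moreover have "fps_nth f 0 = 0"
      using Suc.prems(1) unfolding f_def fps_X_power_dvd_iff_nth by blast
    ultimately show False using b c by (simp add: fps_power_zeroth)
  qed
qed

section \<open>Total degree, and powers of \<open>1 - x\<close> in place of powers of
  \<open>x\<close>\<close>

lemma poly_map_poly_eq_sum: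
  fixes x :: "'b::comm_ring_1"
  assumes "f 0 = 0" "degree p \<le> n"
  shows "poly (map_poly f p) x = (\<Sum>j\<le>n. f (poly.coeff p j) * x ^ j)"
proof -
  have "degree (map_poly f p) \<le> n"
    using assms(2) degree_map_poly_le[of f p] by simp
  then have "poly (map_poly f p) x = (\<Sum>j\<le>n. poly.coeff (map_poly f p) j * x ^ j)"
    unfolding poly_altdef by (intro sum.mono_neutral_left) (auto simp: coeff_eq_0)
  with assms(1) show ?thesis by (simp add: coeff_map_poly)
qed

lemma finite_coeff_degrees: "finite {i + j | i j. poly.coeff (poly.coeff h j) i \<noteq> 0}"
proof -
  have "{i + j | i j. poly.coeff (poly.coeff h j) i \<noteq> 0} \<subseteq>
      (\<Union>j\<le>degree h. (\<lambda>i. i + j) ` {..degree (poly.coeff h j)})"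
    by (force intro!: le_degree)
  then show ?thesis by (rule finite_subset) simp
qed

lemma total_degree_le_iff:
  "total_degree h \<le> d \<longleftrightarrow> (\<forall>i j. poly.coeff (poly.coeff h j) i \<noteq> 0 \<longrightarrow> i + j \<le> d)"
  unfolding total_degree_def using finite_coeff_degrees[of h] by (subst Max_le_iff) auto

text \<open>This is the number of monomials in two variables of total degree at most
  \<open>d\<close>; it enters both bounds on the complexity.\<close>

lemma card_triangle: "card {(i, j). i + j \<le> (d::nat)} = (d + 2) choose 2"
proof -
  have "{(i, j). i + j \<le> d} = (SIGMA i:{..d}. {..d - i})" by auto
  then have "card {(i, j). i + j \<le> d} = (\<Sum>i\<le>d. Suc (d - i))" by simp
  also have "\<dots> = (\<Sum>i\<le>d. Suc i)"
    by (rule sum.reindex_bij_witness[of _ "\<lambda>i. d - i" "\<lambda>i. d - i"]) auto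
  also have "\<dots> = (d + 2) choose 2"
    by (induction d) (auto simp: numeral_2_eq_2)
  finally show ?thesis .
qed

lemma fps_of_poly_pcompose_one_minus_X:
  fixes c :: "'a::field poly"
  assumes "degree c \<le> n"
  shows "fps_of_poly (pcompose c [:1, -1:]) = (\<Sum>a\<le>n. fps_const (poly.coeff c a) * (1 - fps_X) ^ a)"
proof -
  have "pcompose c [:1, -1:] = (\<Sum>a\<le>n. [:poly.coeff c a:] * [:1, -1:] ^ a)"
    unfolding pcompose_altdef using assms by (intro poly_map_poly_eq_sum) auto
  moreover have lin: "fps_of_poly [:1, -1:] = (1 - fps_X :: 'a fps)"
    by (simp add: fps_of_poly_linear')
  ultimately show ?thesis
    by (simp only: fps_of_poly_sum fps_of_poly_mult fps_of_poly_power fps_of_poly_const lin)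
qed

text \<open>Replacing \<open>x\<close> by \<open>1 - x\<close> does not raise the total degree, so
  the coefficients of \<open>h\<close> in the new basis still fit into a triangle of size at most
  \<open>N\<close>, and \<open>log_combination_eq_zero\<close> applies.\<close>

lemma total_degree_log_annihilator:
  fixes G :: "'a::field fps"
  assumes G: "fps_X ^ M dvd (1 - fps_X) * fps_deriv G - 1"
    and char: "\<And>k. 0 < k \<Longrightarrow> k \<le> M \<Longrightarrow> of_nat k \<noteq> (0::'a)"
    and h: "fps_X ^ N dvd subst_fps h G" "total_degree h \<le> m"
    and N: "(m + 2) choose 2 \<le> N" "N \<le> M"
  shows "h = 0"
proof -
  \<comment> \<open>The coefficient of \<open>(1 - x)^a y^j\<close> in \<open>h\<close> is that of
    \<open>x^a\<close> in \<open>c j\<close>, since the substitution is its own inverse. The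
    polynomial \<open>q a\<close> collects these over \<open>j\<close>, turning rows into
    columns.\<close>
  define c where "c = (\<lambda>j. pcompose (poly.coeff h j) [:1, -1:])"
  define q where "q = (\<lambda>a. \<Sum>j\<le>m. Polynomial.monom (poly.coeff (c j) a) j)"
  have h_coeff: "i + j \<le> m" if "poly.coeff (poly.coeff h j) i \<noteq> 0" for i j
    using h(2) that by (simp add: total_degree_le_iff)
  have h_zero: "poly.coeff h j = 0" if "j > m" for j
    using h_coeff[of j] that by (intro poly_eqI) (metis coeff_0 le_add2 not_le order_trans)
  have "degree (poly.coeff h j) \<le> m - j" for j
    by (intro degree_le) (use h_coeff[of j] in fastforce)
  then have deg_c: "degree (c j) \<le> m - j" for j
    unfolding c_def by (simp add: degree_pcompose)
  have deg_h: "degree h \<le> m"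
    using h_zero by (intro degree_le) auto
  have "[:1, -1:] \<circ>\<^sub>p [:1, -1:] = ([:0, 1:] :: 'a poly)"
    by (simp add: pcompose_pCons)
  then have c_inv: "pcompose (c j) [:1, -1:] = poly.coeff h j" for j
    unfolding c_def by (simp flip: pcompose_assoc)
  have coeff_q: "poly.coeff (q a) j = (if j \<le> m then poly.coeff (c j) a else 0)" for a j
    unfolding q_def by (auto simp: coeff_sum)
  have deg_q: "degree (q a) \<le> m" for a
    by (intro degree_le) (simp add: coeff_q)
  have "subst_fps h G = (\<Sum>j\<le>m. fps_of_poly (poly.coeff h j) * G ^ j)"
    unfolding subst_fps_def using deg_h by (intro poly_map_poly_eq_sum) auto
  also have "\<dots> = (\<Sum>j\<le>m. \<Sum>a\<le>m. fps_const (poly.coeff (c j) a) * (1 - fps_X) ^ a * G ^ j)"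
    using deg_c by (intro sum.cong refl, subst c_inv[symmetric],
        subst fps_of_poly_pcompose_one_minus_X[of _ m])
      (auto simp: sum_distrib_right intro: order_trans[OF deg_c])
  also have "\<dots> = (\<Sum>a\<le>m. \<Sum>j\<le>m. fps_const (poly.coeff (c j) a) * (1 - fps_X) ^ a * G ^ j)"
    by (rule sum.swap)
  also have "\<dots> = (\<Sum>a\<le>m. (1 - fps_X) ^ a * eval_const (q a) G)"
    using deg_q by (subst poly_map_poly_eq_sum[of _ _ m])
      (auto simp: sum_distrib_left coeff_q mult_ac intro!: sum.cong)
  finally have subst: "subst_fps h G = (\<Sum>a\<le>m. (1 - fps_X) ^ a * eval_const (q a) G)" .
  have len: "length (coeffs (q a)) \<le> Suc (m - a)" if "a \<le> m" for a
  proof (cases "q a = 0")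
    case False
    then have "lead_coeff (q a) \<noteq> 0" by simp
    then have "degree (q a) \<le> m \<and> poly.coeff (c (degree (q a))) a \<noteq> 0"
      unfolding coeff_q by (auto split: if_splits)
    then have "degree (q a) \<le> m" "a \<le> m - degree (q a)"
      using le_degree deg_c order_trans by blast+
    then show ?thesis using False by (simp add: length_coeffs_degree)
  qed simp
  have "(\<Sum>a\<le>m. length (coeffs (q a))) \<le> (\<Sum>a\<le>m. Suc (m - a))"
    using len by (intro sum_mono) auto
  also have "\<dots> = card (SIGMA a:{..m}. {..m - a})" by simp
  also have "(SIGMA a:{..m}. {..m - a}) = {(i, j). i + j \<le> m}" by auto
  finally have le: "(\<Sum>a\<le>m. length (coeffs (q a))) \<le> N"
    unfolding card_triangle using N(1) by simp
  \<comment> \<open>Hence differences of distinct exponents up to \<open>m\<close> lie within the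
    range of \<open>char\<close>, and the exponents stay distinct in the field.\<close>
  have "m \<le> (m + 2) choose 2" by (simp add: numeral_2_eq_2)
  with N have "m \<le> M" by simp
  have "inj_on (of_nat :: nat \<Rightarrow> 'a) {..m}"
  proof (rule linorder_inj_onI)
    fix a b :: nat assume "a < b" "b \<in> {..m}"
    then have "of_nat (b - a) \<noteq> (0::'a)" using \<open>m \<le> M\<close> by (intro char) auto
    then show "of_nat a \<noteq> (of_nat b :: 'a)" using \<open>a < b\<close> by (simp add: of_nat_diff)
  qed (rule nat_le_linear)
  then have "\<forall>a\<in>{..m}. q a = 0"
    using h(1) le N(2) unfolding subst by (intro log_combination_eq_zero[OF G char]) auto
  then have q0: "poly.coeff (c j) a = 0" if "j \<le> m" "a \<le> m" for j a
    using that coeff_q[of a j] by simp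
  have "c j = 0" if "j \<le> m" for j
    using q0[OF that] deg_c[of j] by (intro poly_eqI) (metis coeff_0 coeff_eq_0 diff_le_self le_trans not_le)
  then have "poly.coeff h j = 0" for j
    using c_inv[of j] h_zero[of j] by (cases "j \<le> m") auto
  then show ?thesis by (intro poly_eqI) simp
qed

section \<open>Annihilating polynomials by counting coefficients\<close>

lemma finite_field_underdetermined_system:
  fixes e :: "'i \<Rightarrow> nat \<Rightarrow> 'a::{field, finite}"
  assumes "finite I" "N < card I"
  obtains c where "\<exists>i\<in>I. c i \<noteq> 0" "\<And>n. n < N \<Longrightarrow> (\<Sum>i\<in>I. c i * e i n) = 0"
proof -
  let ?P = "I \<rightarrow>\<^sub>E (UNIV :: 'a set)" and ?Q = "{..<N} \<rightarrow>\<^sub>E (UNIV :: 'a set)"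
  let ?f = "\<lambda>c. restrict (\<lambda>n. \<Sum>i\<in>I. c i * e i n) {..<N}"
  \<comment> \<open>With at least two scalars, more unknowns than equations means more coefficient
    vectors than value vectors. Two vectors then collide, and by linearity their difference is a
    nontrivial solution.\<close>
  have "card {0, 1 :: 'a} \<le> CARD('a)" by (rule card_mono) auto
  then have "card ?Q < card ?P"
    using assms by (simp add: card_PiE)
  moreover have "card (?f ` ?P) \<le> card ?Q"
    by (intro card_mono finite_PiE image_subsetI restrict_PiE_iff[THEN iffD2]) auto
  ultimately have "\<not> inj_on ?f ?P" by (intro pigeonhole) simp
  then obtain c c' where c: "c \<in> ?P" "c' \<in> ?P" "c \<noteq> c'" "?f c = ?f c'"
    unfolding inj_on_def by blast
  have "(\<Sum>i\<in>I. (c i - c' i) * e i n) = 0" if "n < N" for n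
    using fun_cong[OF c(4), of n] that by (simp add: left_diff_distrib sum_subtractf)
  moreover have "\<exists>i\<in>I. c i - c' i \<noteq> 0"
    using PiE_ext[OF c(1,2)] c(3) by auto
  ultimately show thesis by (rule that[rotated])
qed

lemma subst_fps_add: "subst_fps (h + k) G = subst_fps h G + subst_fps k G"
proof -
  have "map_poly fps_of_poly (h + k) = map_poly fps_of_poly h + map_poly fps_of_poly k"
    by (intro poly_eqI) (simp add: coeff_map_poly fps_of_poly_add)
  then show ?thesis by (simp add: subst_fps_def)
qed

lemma subst_fps_sum: "subst_fps (sum h A) G = (\<Sum>a\<in>A. subst_fps (h a) G)"
  by (induction A rule: infinite_finite_induct) (simp_all add: subst_fps_add, simp_all add: subst_fps_def)

lemma subst_fps_monom: "subst_fps (Polynomial.monom (Polynomial.monom c i) j) G = fps_const c * fps_X ^ i * G ^ j"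
  by (simp add: subst_fps_def map_poly_monom poly_monom fps_of_poly_monom)

text \<open>Each of the first \<open>N\<close> coefficients of \<open>h(X, G)\<close> is a linear
  form in the \<open>(d + 2) choose 2\<close> coefficients of \<open>h\<close>, so there are fewer
  equations than unknowns.\<close>

lemma exists_annihilator:
  fixes G :: "'a::{field, finite} fps"
  assumes "N < (d + 2) choose 2"
  obtains h where "h \<noteq> 0" "total_degree h \<le> d" "fps_X ^ N dvd subst_fps h G"
proof -
  let ?I = "{(i, j). i + j \<le> d}"
  have fin: "finite ?I" by (rule finite_subset[of _ "{..d} \<times> {..d}"]) auto
  obtain c where c: "\<exists>ij\<in>?I. c ij \<noteq> 0"
    and sum0: "\<And>n. n < N \<Longrightarrow> (\<Sum>ij\<in>?I. c ij * fps_nth (fps_X ^ fst ij * G ^ snd ij) n) = 0"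
    by (rule finite_field_underdetermined_system[OF fin, unfolded card_triangle, OF assms,
          where e = "\<lambda>ij. fps_nth (fps_X ^ fst ij * G ^ snd ij)"]) blast
  define h where "h = (\<Sum>ij\<in>?I. Polynomial.monom (Polynomial.monom (c ij) (fst ij)) (snd ij))"
  have coeff_h: "poly.coeff (poly.coeff h j) i = (if i + j \<le> d then c (i, j) else 0)" for i j
  proof -
    have "poly.coeff (poly.coeff h j) i = (\<Sum>ij\<in>?I. if ij = (i, j) then c ij else 0)"
      unfolding h_def by (auto simp: coeff_sum intro!: sum.cong)
    also have "\<dots> = (if i + j \<le> d then c (i, j) else 0)"
      using fin by (subst sum.delta) auto
    finally show ?thesis .
  qed
  show thesis
  proof
    obtain i j where "i + j \<le> d" "c (i, j) \<noteq> 0" using c by blast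
    then show "h \<noteq> 0" using coeff_h[of j i] by auto
    show "total_degree h \<le> d" by (auto simp: total_degree_le_iff coeff_h split: if_splits)
    have "fps_nth (subst_fps h G) n = (\<Sum>ij\<in>?I. c ij * fps_nth (fps_X ^ fst ij * G ^ snd ij) n)" for n
      by (simp add: h_def subst_fps_sum subst_fps_monom fps_sum_nth mult.assoc)
    then show "fps_X ^ N dvd subst_fps h G"
      using sum0 by (simp add: fps_X_power_dvd_iff_nth)
  qed
qed

section \<open>The explicit inversive generator as a truncated logarithm\<close>

lemma of_nat_mult_explicit_inversive:
  assumes "0 < n" "n < CARD('p::prime_card)"
  shows "of_nat n * (explicit_inversive n :: 'p mod_ring) = 1"
proof -
  let ?p = "CARD('p)"
  have p: "prime ?p" by (rule prime_card)
  then have "?p \<ge> 2" by (rule prime_ge_2_nat)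
  have "\<not> ?p dvd n" using assms by (auto dest: dvd_imp_le)
  then have "[n ^ (?p - 1) = 1] (mod ?p)" using p by (rule fermat_theorem[rotated])
  then have "of_nat (n ^ (?p - 1) mod ?p) = (of_nat (1 mod ?p) :: 'p mod_ring)"
    by (simp add: cong_def)
  then have "of_nat n ^ (?p - 1) = (1 :: 'p mod_ring)"
    using of_nat_mod_CHAR[where 'a = "'p mod_ring"] by (simp only: semiring_char_mod_ring) simp
  moreover have "?p - 1 = Suc (?p - 2)" using \<open>?p \<ge> 2\<close> by simp
  moreover have "(explicit_inversive n :: 'p mod_ring) = of_nat n ^ (?p - 2)"
    unfolding explicit_inversive_def
    using of_nat_mod_CHAR[where 'a = "'p mod_ring"] by (simp only: semiring_char_mod_ring) simp
  ultimately show ?thesis by simp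
qed

text \<open>For \<open>i + 1 < p\<close> the coefficient of \<open>X^i\<close> in \<open>G'\<close>
  is \<open>(i + 1)\<close> times its inverse, so \<open>G'\<close> agrees with the geometric series
  up to there. Differentiation costs one order, hence \<open>p - 1\<close> and not
  \<open>p\<close>.\<close>

lemma generating_function_explicit_inversive_deriv:
  fixes G :: "'p::prime_card mod_ring fps"
  defines "G \<equiv> generating_function explicit_inversive"
  shows "fps_X ^ (CARD('p) - 1) dvd (1 - fps_X) * fps_deriv G - 1"
proof -
  have deriv: "fps_nth (fps_deriv G) i = 1" if "Suc i < CARD('p)" for i
    using of_nat_mult_explicit_inversive[of "Suc i", where 'p = 'p] that
    by (simp add: G_def generating_function_def)
  have "fps_nth ((1 - fps_X) * fps_deriv G - 1) i = 0" if "i < CARD('p) - 1" for i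
    using deriv[of i] deriv[of "i - 1"] that
    by (cases i) (simp_all add: left_diff_distrib del: fps_deriv_nth)
  then show ?thesis by (simp add: fps_X_power_dvd_iff_nth)
qed

theorem theorem4:
  fixes p N d :: nat
  assumes "p = CARD('p::prime_card)"
    and "p \<ge> 3"
    and "2 \<le> N" and "N \<le> p - 1"
    and "d \<ge> 1"
    and "(d + 1) choose 2 \<le> N" and "N < (d + 2) choose 2"
  shows "expansion_complexity N (explicit_inversive :: nat \<Rightarrow> 'p mod_ring) = d"
proof -
  let ?s = "explicit_inversive :: nat \<Rightarrow> 'p mod_ring"
  let ?G = "generating_function ?s"
  let ?ann = "\<lambda>D h. h \<noteq> 0 \<and> total_degree h = D \<and> fps_X ^ N dvd subst_fps h ?G"
  \<comment> \<open>Since \<open>N \<ge> 2\<close>, index 1 is in range, which rules out the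
    convention that the complexity is zero.\<close>
  have "?s 1 = 1"
    using of_nat_mult_explicit_inversive[of 1, where 'p = 'p] assms(1,2) by simp
  then have "\<not> (\<forall>i<N. ?s i = 0)" using assms(3) by (intro notI) (auto dest: spec[of _ 1])
  then have E: "expansion_complexity N ?s = (LEAST D. \<exists>h. ?ann D h)"
    unfolding expansion_complexity_def by (rule if_not_P)
  have lower: "d \<le> total_degree h" if "h \<noteq> 0" "fps_X ^ N dvd subst_fps h ?G" for h
  proof (rule ccontr)
    assume "\<not> d \<le> total_degree h"
    \<comment> \<open>With \<open>m = d - 1\<close> and \<open>d \<ge> 1\<close>, the triangle size
      \<open>(m + 2) choose 2\<close> is exactly \<open>(d + 1) choose 2\<close>, the assumed lower
      bound on \<open>N\<close>.\<close>
    then have "total_degree h \<le> d - 1" by simp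
    moreover have "of_nat k \<noteq> (0 :: 'p mod_ring)" if "0 < k" "k \<le> p - 1" for k
      using of_nat_0_mod_ring_dvd[of k, where 'a = 'p] that assms(1,2) by (fastforce dest: dvd_imp_le)
    ultimately have "h = 0"
      using that(2) assms generating_function_explicit_inversive_deriv[where 'p = 'p]
      by (intro total_degree_log_annihilator[of "p - 1" ?G N h "d - 1"]) auto
    with that(1) show False by simp
  qed
  obtain h where h: "h \<noteq> 0" "total_degree h \<le> d" "fps_X ^ N dvd subst_fps h ?G"
    using exists_annihilator[OF assms(7)] by blast
  show ?thesis
    unfolding E
  proof (rule Least_equality)
    \<comment> \<open>Counting gives degree at most \<open>d\<close> only; the lower bound makes it
      equal to \<open>d\<close>.\<close>
    show "\<exists>h. ?ann d h" using h lower by (metis le_antisym)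
    show "d \<le> D" if "\<exists>h. ?ann D h" for D using that lower by blast
  qed
qed

end
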